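(* Let $V$ be a real vector space of dimension $n$, let $S$ be a commutative subsemigroup (or subgroup) of $GL(V)$, let $G$ be the Zariski closure of $S$ in $GL(V)$, and let $T$ be the maximal compact connected subgroup of $G$. If $S$ has a somewhere dense orbit in $V$, then $S$ has at least $n+1-\dim T$ generators.
   Context: A point $x\in V$ has a somewhere dense $S$-orbit if the closure of $S(x)=\{sx:s\in S\}$ contains a non-empty open subset of $V$; $S$ has a somewhere dense orbit if some $x\in V$ does. *)

theory Defs
  imports "HOL-Analysis.Analysis"
begin

type_synonym 'n mat = "real ^ 'n ^ 'n"

inductive_set poly_fun :: "('n::finite mat \<Rightarrow> real) set" where
  const: "(\<lambda>A. c) \<in> poly_fun"
| coord: "(\<lambda>A. A $ i $ j) \<in> poly_fun"
| add: "p \<in> poly_fun \<Longrightarrow> q \<in> poly_fun \<Longrightarrow> (\<lambda>A. p A + q A) \<in> poly_fun"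
| mult: "p \<in> poly_fun \<Longrightarrow> q \<in> poly_fun \<Longrightarrow> (\<lambda>A. p A * q A) \<in> poly_fun"

definition zariski_closure_GL :: "'n::finite mat set \<Rightarrow> 'n mat set" where
  "zariski_closure_GL S = {A. invertible A \<and>
      (\<forall>p\<in>poly_fun. (\<forall>B\<in>S. p B = 0) \<longrightarrow> p A = 0)}"

definition is_subsemigroup_GL :: "'n::finite mat set \<Rightarrow> bool" where
  "is_subsemigroup_GL S \<longleftrightarrow> S \<noteq> {} \<and> (\<forall>A\<in>S. invertible A) \<and> (\<forall>A\<in>S. \<forall>B\<in>S. A ** B \<in> S)"

definition is_subgroup_GL :: "'n::finite mat set \<Rightarrow> bool" where
  "is_subgroup_GL H \<longleftrightarrow> mat 1 \<in> H \<and> (\<forall>A\<in>H. invertible A) \<and>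
     (\<forall>A\<in>H. \<forall>B\<in>H. A ** B \<in> H) \<and> (\<forall>A\<in>H. matrix_inv A \<in> H)"

definition compact_connected_subgroup :: "'n::finite mat set \<Rightarrow> 'n mat set \<Rightarrow> bool" where
  "compact_connected_subgroup H G \<longleftrightarrow> H \<subseteq> G \<and> is_subgroup_GL H \<and> compact H \<and> connected H"

definition maximal_compact_connected_subgroup :: "'n::finite mat set \<Rightarrow> 'n mat set \<Rightarrow> bool" where
  "maximal_compact_connected_subgroup T G \<longleftrightarrow> compact_connected_subgroup T G \<and>
     (\<forall>H. compact_connected_subgroup H G \<and> T \<subseteq> H \<longrightarrow> H = T)"

definition lie_algebra :: "'n::finite mat set \<Rightarrow> 'n mat set" where
  "lie_algebra H = {X. \<exists>\<gamma>. (\<forall>t. \<gamma> t \<in> H) \<and> \<gamma> 0 = mat 1 \<and> (\<gamma> has_vector_derivative X) (at 0)}"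

definition lie_dim :: "'n::finite mat set \<Rightarrow> nat" where
  "lie_dim H = dim (span (lie_algebra H))"

inductive_set sgr_gen :: "'n::finite mat set \<Rightarrow> 'n mat set" for F where
  base: "A \<in> F \<Longrightarrow> A \<in> sgr_gen F"
| mult: "A \<in> sgr_gen F \<Longrightarrow> B \<in> sgr_gen F \<Longrightarrow> A ** B \<in> sgr_gen F"

inductive_set grp_gen :: "'n::finite mat set \<Rightarrow> 'n mat set" for F where
  base: "A \<in> F \<Longrightarrow> A \<in> grp_gen F"
| one: "mat 1 \<in> grp_gen F"
| mult: "A \<in> grp_gen F \<Longrightarrow> B \<in> grp_gen F \<Longrightarrow> A ** B \<in> grp_gen F"
| inv: "A \<in> grp_gen F \<Longrightarrow> matrix_inv A \<in> grp_gen F"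

definition orbit :: "'n::finite mat set \<Rightarrow> real ^ 'n \<Rightarrow> (real ^ 'n) set" where
  "orbit S x = {s *v x | s. s \<in> S}"

definition somewhere_dense_orbit :: "'n::finite mat set \<Rightarrow> bool" where
  "somewhere_dense_orbit S \<longleftrightarrow> (\<exists>x. interior (closure (orbit S x)) \<noteq> {})"

end

theory Submission
  imports Defs "HOL-Computational_Algebra.Polynomial"
begin

text \<open>Let \<open>x\<close> have a somewhere dense orbit and let \<open>\<A>\<close> be the linear span of \<open>S\<close>. As \<open>S\<close> is
  commutative, evaluation at \<open>x\<close> is a linear isomorphism from the algebra \<open>\<A>\<close> onto \<open>V\<close>, so \<open>S\<close> is
  somewhere dense in \<open>\<A>\<close> and its Zariski closure is the group of units of \<open>\<A>\<close>. The exponential of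
  \<open>\<A>\<close> is locally onto near \<open>0\<close>, its image contains the squares of all units, and its kernel lies
  in the Lie algebra of \<open>T\<close>, because every kernel element generates a compact
  one-parameter group, which maximality puts into \<open>T\<close>.
  If there were at most \<open>n - dim T\<close> generators, then some nonzero linear functional on \<open>\<A>\<close> would vanish
  on that kernel and be integral on chosen logarithms of the squares of the generators, hence on
  all logarithms of squares of elements of \<open>S\<close>. Density of \<open>S\<close> near one of its points excludes this.\<close>

section \<open>The matrix exponential\<close>

text \<open>The type of real matrices is not an instance of the class of Banach algebras, on which the
  library defines the exponential; a copy of the bounded operators on \<open>real ^ 'n\<close> is.\<close>

typedef (overloaded) ('n::finite) endo = "UNIV :: ((real ^ 'n) \<Rightarrow>\<^sub>L (real ^ 'n)) set" ..

setup_lifting type_definition_endo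

instantiation endo :: (finite) real_normed_algebra_1
begin

lift_definition zero_endo :: "'a endo" is 0 .
lift_definition one_endo :: "'a endo" is id_blinfun .
lift_definition plus_endo :: "'a endo \<Rightarrow> 'a endo \<Rightarrow> 'a endo" is "(+)" .
lift_definition minus_endo :: "'a endo \<Rightarrow> 'a endo \<Rightarrow> 'a endo" is "(-)" .
lift_definition uminus_endo :: "'a endo \<Rightarrow> 'a endo" is uminus .
lift_definition times_endo :: "'a endo \<Rightarrow> 'a endo \<Rightarrow> 'a endo" is blinfun_compose .
lift_definition scaleR_endo :: "real \<Rightarrow> 'a endo \<Rightarrow> 'a endo" is scaleR .
lift_definition norm_endo :: "'a endo \<Rightarrow> real" is norm .

definition dist_endo :: "'a endo \<Rightarrow> 'a endo \<Rightarrow> real"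
  where "dist_endo f g = norm (f - g)"
definition sgn_endo :: "'a endo \<Rightarrow> 'a endo"
  where "sgn_endo f = inverse (norm f) *\<^sub>R f"
definition uniformity_endo :: "('a endo \<times> 'a endo) filter"
  where "uniformity_endo = (INF e\<in>{0<..}. principal {(f, g). dist f g < e})"
definition open_endo :: "'a endo set \<Rightarrow> bool"
  where "open_endo U = (\<forall>f\<in>U. eventually (\<lambda>(f', g). f' = f \<longrightarrow> g \<in> U) uniformity)"

instance
proof
  fix f g h :: "'a endo" and r s :: real
  show "f + g + h = f + (g + h)" "f + g = g + f" "0 + f = f" "- f + f = 0" "f - g = f + - g"
    by (transfer; simp)+
  show "f * g * h = f * (g * h)" "(f + g) * h = f * h + g * h" "f * (g + h) = f * g + f * h"
    "1 * f = f" "f * 1 = f"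
    by (transfer; simp add: blinfun_eqI blinfun.add_left blinfun.add_right)+
  show "r *\<^sub>R (f + g) = r *\<^sub>R f + r *\<^sub>R g" "(r + s) *\<^sub>R f = r *\<^sub>R f + s *\<^sub>R f"
    "r *\<^sub>R s *\<^sub>R f = (r * s) *\<^sub>R f" "1 *\<^sub>R f = f"
    by (transfer; simp add: scaleR_add_left scaleR_add_right)+
  show "r *\<^sub>R f * g = r *\<^sub>R (f * g)" "f * r *\<^sub>R g = r *\<^sub>R (f * g)"
    by (transfer; simp add: blinfun_eqI blinfun.scaleR_left blinfun.scaleR_right)+
  show "dist f g = norm (f - g)"
    by (rule dist_endo_def)
  show "sgn f = inverse (norm f) *\<^sub>R f"
    by (rule sgn_endo_def)
  show "(uniformity :: ('a endo \<times> 'a endo) filter) = (INF e\<in>{0<..}. principal {(f, g). dist f g < e})"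
    by (rule uniformity_endo_def)
  show "open U \<longleftrightarrow> (\<forall>f\<in>U. \<forall>\<^sub>F (f', g) in uniformity. f' = f \<longrightarrow> g \<in> U)" for U :: "'a endo set"
    by (rule open_endo_def)
  show "norm f = 0 \<longleftrightarrow> f = 0" "norm (r *\<^sub>R f) = \<bar>r\<bar> * norm f"
    by (transfer; simp)+
  show "norm (f + g) \<le> norm f + norm g"
    by transfer (rule norm_triangle_ineq)
  show "norm (f * g) \<le> norm f * norm g"
    by transfer (rule norm_blinfun_compose)
  show "(0 :: 'a endo) \<noteq> 1"
  proof transfer
    have "blinfun_apply (0 :: (real ^ 'a) \<Rightarrow>\<^sub>L (real ^ 'a)) 1 \<noteq> blinfun_apply id_blinfun 1"
      by simp
    then show "(0 :: (real ^ 'a) \<Rightarrow>\<^sub>L (real ^ 'a)) \<noteq> id_blinfun"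
      by metis
  qed
  show "norm (1 :: 'a endo) = 1"
    by transfer simp
qed

end

text \<open>The representation is an isometry, which carries completeness over from the bounded
  operators.\<close>

lemma dist_Rep_endo: "dist (Rep_endo f) (Rep_endo g) = dist f g"
  unfolding dist_norm by transfer rule

instance endo :: (finite) banach
proof
  fix X :: "nat \<Rightarrow> 'a endo"
  assume "Cauchy X"
  then have "Cauchy (\<lambda>k. Rep_endo (X k))"
    by (simp add: Cauchy_def dist_Rep_endo)
  then obtain l where "(\<lambda>k. Rep_endo (X k)) \<longlonglongrightarrow> l"
    using Cauchy_convergent convergent_def by blast
  then have "(\<lambda>k. Rep_endo (X k)) \<longlonglongrightarrow> Rep_endo (Abs_endo l)"
    by (simp add: Abs_endo_inverse)
  then have "X \<longlonglongrightarrow> Abs_endo l"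
    by (simp add: LIMSEQ_def dist_Rep_endo)
  then show "convergent X"
    by (auto simp: convergent_def)
qed

section \<open>Translation between matrices and operators\<close>

lift_definition endo_of_mat :: "'n::finite mat \<Rightarrow> 'n endo" is "\<lambda>A. Blinfun (\<lambda>v. A *v v)" .

lift_definition mat_of_endo :: "'n::finite endo \<Rightarrow> 'n mat" is "\<lambda>f. matrix (blinfun_apply f)" .

lemma blinfun_apply_Blinfun_mat: "blinfun_apply (Blinfun (\<lambda>v. A *v v)) v = A *v (v :: real ^ 'n)"
  by (simp add: bounded_linear_Blinfun_apply)

lemma endo_of_mat_inverse [simp]: "mat_of_endo (endo_of_mat A) = A"
  by transfer (simp add: blinfun_apply_Blinfun_mat[abs_def])

lemma mat_of_endo_apply: "mat_of_endo f *v v = blinfun_apply (Rep_endo f) v"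
  by transfer (simp add: matrix_works linear_matrix_vector_mul_eq bounded_linear.linear
      blinfun.bounded_linear_right)

lemma endo_eq_iff: "f = g \<longleftrightarrow> (\<forall>v. blinfun_apply (Rep_endo f) v = blinfun_apply (Rep_endo g) v)"
  by (metis Rep_endo_inject blinfun_eqI)

lemma Rep_endo_of_mat_apply: "blinfun_apply (Rep_endo (endo_of_mat A)) v = A *v v"
  by (simp add: endo_of_mat.rep_eq blinfun_apply_Blinfun_mat)

lemma mat_of_endo_inverse [simp]: "endo_of_mat (mat_of_endo f) = f"
  by (simp add: endo_eq_iff Rep_endo_of_mat_apply mat_of_endo_apply)

lemma mat_of_endo_mult: "mat_of_endo (f * g) = mat_of_endo f ** mat_of_endo g"
  unfolding matrix_eq
  by (simp add: matrix_vector_mul_assoc[symmetric] mat_of_endo_apply times_endo.rep_eq)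

lemma mat_of_endo_one [simp]: "mat_of_endo 1 = mat 1"
  unfolding matrix_eq by (simp add: mat_of_endo_apply one_endo.rep_eq)

lemma endo_of_mat_mult: "endo_of_mat (A ** B) = endo_of_mat A * endo_of_mat B"
  by (metis endo_of_mat_inverse mat_of_endo_inverse mat_of_endo_mult)

lemma bounded_linear_endo_of_mat: "bounded_linear endo_of_mat"
proof -
  have "linear endo_of_mat"
    by (rule linearI)
      (simp_all add: endo_eq_iff Rep_endo_of_mat_apply plus_endo.rep_eq scaleR_endo.rep_eq
        plus_blinfun.rep_eq scaleR_blinfun.rep_eq matrix_vector_mult_add_rdistrib
        scaleR_matrix_vector_assoc)
  then show ?thesis
    by (rule linear_conv_bounded_linear[THEN iffD1])
qed

lemma bounded_linear_mat_of_endo: "bounded_linear mat_of_endo"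
proof (rule bounded_linear_intro[where K = "real (CARD('a)) * real (CARD('a))"])
  show "mat_of_endo (f + g) = mat_of_endo f + mat_of_endo g" for f g :: "'a endo"
    unfolding matrix_eq
    by (simp add: mat_of_endo_apply plus_endo.rep_eq plus_blinfun.rep_eq
        matrix_vector_mult_add_rdistrib)
  show "mat_of_endo (c *\<^sub>R f) = c *\<^sub>R mat_of_endo f" for c and f :: "'a endo"
    unfolding matrix_eq
    by (simp add: mat_of_endo_apply scaleR_endo.rep_eq scaleR_blinfun.rep_eq
        scaleR_matrix_vector_assoc[symmetric])
  fix f :: "'a endo"
  \<comment> \<open>An entry is a coordinate of the image of a basis vector, so the operator norm
    bounds it; summing over all entries gives the constant.\<close>
  have "\<bar>mat_of_endo f $ i $ j\<bar> \<le> norm f" for i j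
  proof -
    have "\<bar>mat_of_endo f $ i $ j\<bar> = \<bar>(mat_of_endo f *v axis j 1) $ i\<bar>"
      by (simp add: matrix_vector_mult_basis column_def)
    also have "\<dots> \<le> norm (blinfun_apply (Rep_endo f) (axis j 1))"
      by (simp add: mat_of_endo_apply component_le_norm_cart)
    also have "\<dots> \<le> norm (Rep_endo f) * norm (axis j (1::real))"
      by (rule norm_blinfun)
    finally show ?thesis
      by (simp add: norm_endo.rep_eq norm_axis_1)
  qed
  then have "norm (mat_of_endo f $ i) \<le> (\<Sum>j\<in>(UNIV :: 'a set). norm f)" for i
    using norm_le_l1_cart[of "mat_of_endo f $ i"] by (meson order_trans sum_mono)
  then have "(\<Sum>i\<in>UNIV. norm (mat_of_endo f $ i)) \<le> (\<Sum>i\<in>(UNIV :: 'a set). \<Sum>j\<in>(UNIV :: 'a set). norm f)"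
    by (meson sum_mono)
  moreover have "norm (mat_of_endo f) \<le> (\<Sum>i\<in>UNIV. norm (mat_of_endo f $ i))"
    unfolding norm_vec_def by (rule L2_set_le_sum) simp
  ultimately show "norm (mat_of_endo f) \<le> norm f * (real (CARD('a)) * real (CARD('a)))"
    by (simp add: mult_ac)
qed

lemma bounded_bilinear_matrix_vector_mult:
  "bounded_bilinear ((*v) :: 'n::finite mat \<Rightarrow> real ^ 'n \<Rightarrow> real ^ 'n)"
proof -
  have "bilinear ((*v) :: 'n mat \<Rightarrow> real ^ 'n \<Rightarrow> real ^ 'n)"
    unfolding bilinear_def
    by (intro conjI allI linearI)
      (simp_all only: matrix_vector_mult_add_rdistrib matrix_vector_right_distrib
        matrix_vector_mult_scaleR scaleR_matrix_vector_assoc)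
  then show ?thesis
    by (simp add: bilinear_conv_bounded_bilinear)
qed

lemma bounded_bilinear_matrix_mult: "bounded_bilinear ((**) :: 'n::finite mat \<Rightarrow> 'n mat \<Rightarrow> 'n mat)"
proof -
  have "bilinear ((**) :: 'n mat \<Rightarrow> 'n mat \<Rightarrow> 'n mat)"
    unfolding bilinear_def
    by (intro conjI allI linearI)
      (simp_all add: matrix_eq matrix_vector_mul_assoc[symmetric] matrix_vector_mult_add_rdistrib
        matrix_vector_right_distrib matrix_vector_mult_scaleR scaleR_matrix_vector_assoc[symmetric])
  then show ?thesis
    by (simp add: bilinear_conv_bounded_bilinear)
qed

lemmas tendsto_matrix_mult = bounded_bilinear.tendsto[OF bounded_bilinear_matrix_mult]
lemmas continuous_on_matrix_mult = bounded_bilinear.continuous_on[OF bounded_bilinear_matrix_mult]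

section \<open>The exponential of matrices\<close>

definition mexp :: "'n::finite mat \<Rightarrow> 'n mat" where
  "mexp A = mat_of_endo (exp (endo_of_mat A))"

lemma mexp_0 [simp]: "mexp 0 = mat 1"
  by (simp add: mexp_def bounded_linear.linear[OF bounded_linear_endo_of_mat, THEN linear_0])

lemma mexp_add_commuting:
  assumes "A ** B = B ** A"
  shows "mexp (A + B) = mexp A ** mexp B"
proof -
  have "endo_of_mat A * endo_of_mat B = endo_of_mat B * endo_of_mat A"
    using assms by (metis endo_of_mat_mult)
  then show ?thesis
    by (simp add: mexp_def exp_add_commuting mat_of_endo_mult
        linear_add[OF bounded_linear.linear[OF bounded_linear_endo_of_mat]])
qed

lemma matrix_neg_mult: "(- A) ** B = - (A ** B)" for A B :: "'n::finite mat"
  by (rule bounded_bilinear.minus_left[OF bounded_bilinear_matrix_mult])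

lemma matrix_mult_neg: "A ** (- B) = - (A ** B)" for A B :: "'n::finite mat"
  by (rule bounded_bilinear.minus_right[OF bounded_bilinear_matrix_mult])

lemma mexp_minus: "mexp A ** mexp (- A) = mat 1"
  by (subst mexp_add_commuting[symmetric]) (simp_all add: matrix_neg_mult matrix_mult_neg)

lemma invertible_mexp: "invertible (mexp A)"
  using invertible_right_inverse mexp_minus by blast

text \<open>The series from degree two on is dominated termwise by that of the real exponential at
  \<open>norm x\<close>.\<close>

lemma norm_exp_minus_linear_le:
  fixes x :: "'a::{real_normed_algebra_1, banach}"
  assumes "norm x \<le> 1"
  shows "norm (exp x - 1 - x) \<le> (norm x)\<^sup>2"
proof -
  let ?f = "\<lambda>n. inverse (fact (n + 2)) *\<^sub>R x ^ (n + 2)"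
  let ?g = "\<lambda>n. inverse (fact (n + 2)) *\<^sub>R norm x ^ (n + 2)"
  have g: "summable ?g"
    using summable_exp_generic[of "norm x"] by (subst summable_iff_shift)
  have fg: "norm (?f n) \<le> ?g n" for n
    using norm_power_ineq[of x "n + 2"] by (simp add: mult_left_mono del: power_Suc)
  have "norm (exp x - 1 - x) = norm (suminf ?f)"
    by (subst exp_first_two_terms) simp
  also have "\<dots> \<le> suminf ?g"
    by (rule norm_suminf_le[OF fg g])
  also have "\<dots> = exp (norm x) - 1 - norm x"
    by (subst exp_first_two_terms) simp
  also have "\<dots> \<le> (norm x)\<^sup>2"
    using exp_bound[of "norm x"] assms by simp
  finally show ?thesis .
qed

lemma exp_has_derivative_at_0:
  "((exp :: 'a::{real_normed_algebra_1, banach} \<Rightarrow> 'a) has_derivative (\<lambda>h. h)) (at 0)"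
  unfolding has_derivative_at
proof (intro conjI bounded_linear_ident)
  have ev: "\<forall>\<^sub>F h :: 'a in at 0. norm h < 1"
    using eventually_at_ball[of 1 "0::'a" UNIV] by (auto elim: eventually_mono)
  show "((\<lambda>h :: 'a. norm (exp (0 + h) - exp 0 - h) / norm h) \<longlongrightarrow> 0) (at 0)"
  proof (rule tendsto_sandwich[OF _ _ tendsto_const])
    show "\<forall>\<^sub>F h :: 'a in at 0. norm (exp (0 + h) - exp 0 - h) / norm h \<le> norm h"
      using ev
    proof eventually_elim
      case (elim h)
      then show ?case
        using norm_exp_minus_linear_le[of h]
        by (cases "h = 0") (simp_all add: pos_divide_le_eq power2_eq_square)
    qed
    show "((\<lambda>h :: 'a. norm h) \<longlongrightarrow> 0) (at 0)"
      by (simp add: tendsto_norm_zero)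
  qed simp
qed

text \<open>The derivative at the origin serves both continuity and local surjectivity on a
  commutative algebra, where multiplication by exponentials reduces other points to this
  one.\<close>

lemma mexp_has_derivative_at_0: "(mexp has_derivative (\<lambda>H. H)) (at (0 :: 'n::finite mat))"
proof -
  interpret e: bounded_linear "endo_of_mat :: 'n mat \<Rightarrow> 'n endo"
    by (rule bounded_linear_endo_of_mat)
  have "((\<lambda>A. exp (endo_of_mat A)) has_derivative (\<lambda>H. endo_of_mat H)) (at (0 :: 'n mat))"
    using diff_chain_at[OF e.has_derivative[OF has_derivative_ident], of exp "\<lambda>h. h" 0]
      exp_has_derivative_at_0
    by (simp add: o_def e.zero)
  from bounded_linear.has_derivative[OF bounded_linear_mat_of_endo this] show ?thesis
    by (simp add: mexp_def[abs_def])
qed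

lemma mexp_scaleR_has_vector_derivative:
  "((\<lambda>t. mexp (t *\<^sub>R A)) has_vector_derivative mexp (t *\<^sub>R A) ** A) (at t)"
proof -
  interpret e: bounded_linear endo_of_mat
    by (rule bounded_linear_endo_of_mat)
  show ?thesis
    using bounded_linear.has_vector_derivative[OF bounded_linear_mat_of_endo
        exp_scaleR_has_vector_derivative_right[of "endo_of_mat A" t UNIV]]
    by (simp add: mexp_def[abs_def] e.scaleR mat_of_endo_mult)
qed

lemma continuous_on_mexp_scaleR: "continuous_on S (\<lambda>t. mexp (t *\<^sub>R A))"
  by (intro continuous_at_imp_continuous_on ballI)
    (rule has_vector_derivative_continuous[OF mexp_scaleR_has_vector_derivative])

text \<open>The partial sums of the series stay in \<open>S\<close>, and subspaces in finite
  dimension are closed.\<close>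

lemma mexp_in_subalgebra:
  assumes "subspace S" "mat 1 \<in> S" "\<And>A B. A \<in> S \<Longrightarrow> B \<in> S \<Longrightarrow> A ** B \<in> S" "A \<in> S"
  shows "mexp A \<in> S"
proof -
  interpret m: bounded_linear mat_of_endo
    by (rule bounded_linear_mat_of_endo)
  have pow: "mat_of_endo (endo_of_mat A ^ k) \<in> S" for k
    by (induction k) (auto simp: mat_of_endo_mult assms)
  have "(\<lambda>k. (endo_of_mat A ^ k) /\<^sub>R fact k) sums exp (endo_of_mat A)"
    by (rule exp_converges)
  then have "(\<lambda>k. mat_of_endo ((endo_of_mat A ^ k) /\<^sub>R fact k)) sums mexp A"
    unfolding mexp_def by (rule m.sums)
  then have "(\<lambda>n. \<Sum>k<n. mat_of_endo (endo_of_mat A ^ k) /\<^sub>R fact k) \<longlonglongrightarrow> mexp A"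
    by (simp add: sums_def m.scaleR)
  moreover have "(\<Sum>k<n. mat_of_endo (endo_of_mat A ^ k) /\<^sub>R fact k) \<in> S" for n
    by (intro subspace_sum subspace_scale pow assms)
  ultimately show ?thesis
    by (rule closed_sequentially[OF closed_subspace[OF assms(1)], rotated])
qed

section \<open>Determinants along a complex line\<close>

text \<open>In the Leibniz expansion every matrix entry is a polynomial of degree at most one in
  \<open>z\<close>.\<close>

lemma det_affine_poly:
  fixes C D :: "'a::comm_ring_1 ^ 'n::finite ^ 'n"
  shows "\<exists>p. \<forall>z. det (\<chi> i j. C $ i $ j + z * D $ i $ j) = poly p z"
proof (intro exI allI)
  show "det (\<chi> i j. C $ i $ j + z * D $ i $ j) =
    poly (\<Sum>\<pi>\<in>{\<pi>. \<pi> permutes UNIV}. [:of_int (sign \<pi>):] *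
      (\<Prod>i\<in>UNIV. [:C $ i $ \<pi> i, D $ i $ \<pi> i:])) z" for z
    by (simp add: det_def poly_sum poly_prod)
qed

lemma det_complex_of_real:
  fixes C :: "'n::finite mat"
  shows "det (\<chi> i j. complex_of_real (C $ i $ j)) = of_real (det C)"
  by (simp add: det_def)

text \<open>The matrix is the product of \<open>1 + z N\<close> and its complex conjugate, so its
  determinant is \<open>poly p z * poly p (cnj z)\<close>, where \<open>p\<close> is nonzero because
  its value at 0 is the determinant of the identity.\<close>

lemma finite_singular_norm_form:
  fixes N :: "'n::finite mat"
  shows "finite {z :: complex. \<not> invertible (mat 1 + (2 * Re z) *\<^sub>R N + (cmod z)\<^sup>2 *\<^sub>R (N ** N))}"
    (is "finite ?S")
proof -
  define C where "C z = (\<chi> i j. (mat 1 :: complex ^ 'n ^ 'n) $ i $ j + z * of_real (N $ i $ j))"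
    for z :: complex
  obtain p where p: "\<And>z. det (C z) = poly p z"
    using det_affine_poly[of "mat 1" "\<chi> i j. of_real (N $ i $ j)"] by (auto simp: C_def)
  have "C 0 = mat 1"
    by (simp add: C_def vec_eq_iff)
  then have "poly p 0 \<noteq> 0"
    using p[of 0] by simp
  then have fin: "finite {z. poly p z = 0}"
    by (intro poly_roots_finite) auto
  have "z \<in> {z. poly p z = 0} \<union> cnj ` {z. poly p z = 0}" if "z \<in> ?S" for z
  proof -
    let ?g = "mat 1 + (2 * Re z) *\<^sub>R N + (cmod z)\<^sup>2 *\<^sub>R (N ** N)"
    have norm_z: "z * cnj z = of_real ((cmod z)\<^sup>2)" "of_real (2 * Re z) = z + cnj z"
      by (simp_all only: complex_norm_square complex_add_cnj)
    have entry: "(C z ** C (cnj z)) $ i $ j = of_real (?g $ i $ j)" for i j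
    proof -
      have "(C z ** C (cnj z)) $ i $ j = (\<Sum>k\<in>UNIV. ((if i = k then 1 else 0) + z * of_real (N $ i $ k)) *
          ((if k = j then 1 else 0) + cnj z * of_real (N $ k $ j)))"
        by (simp add: C_def matrix_matrix_mult_def mat_def)
      \<comment> \<open>Each Kronecker delta is isolated in an \<open>if\<close> so that its sum
        over \<open>k\<close> collapses.\<close>
      also have "\<dots> = (\<Sum>k\<in>UNIV. (if i = k then (if k = j then 1 else 0) + cnj z * of_real (N $ k $ j) else 0)
          + (if k = j then z * of_real (N $ i $ k) else 0)
          + (z * cnj z) * (of_real (N $ i $ k) * of_real (N $ k $ j)))"
        by (intro sum.cong refl) (simp add: algebra_simps)
      also have "\<dots> = (if i = j then 1 else 0) + cnj z * of_real (N $ i $ j) + z * of_real (N $ i $ j)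
          + (z * cnj z) * of_real ((N ** N) $ i $ j)"
        by (simp add: sum.distrib sum_distrib_left[symmetric] matrix_matrix_mult_def)
      also have "\<dots> = (if i = j then 1 else 0) + (z + cnj z) * of_real (N $ i $ j)
          + (z * cnj z) * of_real ((N ** N) $ i $ j)"
        by (simp add: algebra_simps)
      also have "\<dots> = of_real (?g $ i $ j)"
        unfolding norm_z(1) norm_z(2)[symmetric] by (simp add: mat_def)
      finally show ?thesis .
    qed
    have "C z ** C (cnj z) = (\<chi> i j. of_real (?g $ i $ j))"
      by (simp add: vec_eq_iff entry)
    then have "det (C z) * det (C (cnj z)) = of_real (det ?g)"
      by (metis det_mul det_complex_of_real)
    moreover have "det ?g = 0"
      using that invertible_det_nz by auto
    ultimately have "poly p z = 0 \<or> poly p (cnj z) = 0"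
      by (simp add: p)
    then show ?thesis
      by (metis (mono_tags) UnI1 UnI2 complex_cnj_cnj imageI mem_Collect_eq)
  qed
  then have "?S \<subseteq> {z. poly p z = 0} \<union> cnj ` {z. poly p z = 0}"
    by blast
  then show ?thesis
    by (rule finite_subset) (use fin in simp)
qed

section \<open>Inverse matrices and polynomial functions\<close>

lemma matrix_inv_right: "A ** matrix_inv A = mat 1" if "invertible A" for A :: "'n::finite mat"
  using that someI_ex[of "\<lambda>B. A ** B = mat 1 \<and> B ** A = mat 1"]
  by (auto simp: invertible_def matrix_inv_def)

lemma matrix_inv_eqI: "matrix_inv A = B" if "A ** B = mat 1" for A B :: "'n::finite mat"
proof -
  have BA: "B ** A = mat 1"
    using that matrix_left_right_inverse by blast
  have "invertible A"
    using that invertible_right_inverse by blast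
  then have "(B ** A) ** matrix_inv A = B"
    by (simp add: matrix_mul_assoc[symmetric] matrix_inv_right)
  then show ?thesis
    by (simp add: BA)
qed

lemma poly_fun_sum: "finite I \<Longrightarrow> (\<And>i. i \<in> I \<Longrightarrow> p i \<in> poly_fun) \<Longrightarrow> (\<lambda>A. \<Sum>i\<in>I. p i A) \<in> poly_fun"
  by (induction I rule: finite_induct) (auto intro: poly_fun.intros)

lemma poly_fun_inner: "(\<lambda>A. D \<bullet> A) \<in> poly_fun"
  unfolding inner_vec_def by (auto intro!: poly_fun_sum poly_fun.intros)

lemma continuous_on_poly_fun: "p \<in> poly_fun \<Longrightarrow> continuous_on S p"
  by (induction rule: poly_fun.induct) (auto intro!: continuous_intros)

text \<open>Restriction to a line reduces vanishing questions to univariate polynomials, which have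
  finitely many roots unless they are zero.\<close>

lemma poly_fun_affine_line:
  "p \<in> poly_fun \<Longrightarrow> \<exists>q. \<forall>t. p (C + t *\<^sub>R D) = poly q t"
proof (induction rule: poly_fun.induct)
  case (const c)
  show ?case
    by (rule exI[of _ "[:c:]"]) simp
next
  case (coord i j)
  show ?case
    by (rule exI[of _ "[:C $ i $ j, D $ i $ j:]"]) simp
next
  case (add p q)
  then show ?case
    by (metis poly_add)
next
  case (mult p q)
  then show ?case
    by (metis poly_mult)
qed

section \<open>Commutative matrix algebras with a cyclic vector\<close>

text \<open>The instance in view is the linear span of \<open>S\<close>. The cyclic vector yields
  the identity and inverses in \<open>one_in\<close> and \<open>inv_in\<close>.\<close>

locale cyclic_algebra =
  fixes \<A> :: "'n::finite mat set" and x :: "real ^ 'n"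
  assumes subspace: "subspace \<A>"
    and mult_in: "A \<in> \<A> \<Longrightarrow> B \<in> \<A> \<Longrightarrow> A ** B \<in> \<A>"
    and mult_commute: "A \<in> \<A> \<Longrightarrow> B \<in> \<A> \<Longrightarrow> A ** B = B ** A"
    and cyclic: "(\<lambda>A. A *v x) ` \<A> = UNIV"
begin

lemma obtain_eval:
  obtains A where "A \<in> \<A>" "A *v x = v"
  using cyclic by (metis UNIV_I imageE)

text \<open>By cyclicity every vector is \<open>C *v x\<close> with \<open>C\<close> in the algebra,
  and commutativity turns \<open>A *v (C *v x)\<close> into \<open>C *v (A *v x)\<close>.\<close>

lemma eval_inject:
  assumes "A \<in> \<A>" "B \<in> \<A>" "A *v x = B *v x"
  shows "A = B"
  unfolding matrix_eq
proof
  fix v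
  obtain C where C: "C \<in> \<A>" "C *v x = v"
    by (rule obtain_eval)
  have "A *v v = C *v (A *v x)"
    using assms(1) C by (metis matrix_vector_mul_assoc mult_commute)
  also have "\<dots> = C *v (B *v x)"
    by (simp add: assms(3))
  also have "\<dots> = B *v v"
    using assms(2) C by (metis matrix_vector_mul_assoc mult_commute)
  finally show "A *v v = B *v v" .
qed

text \<open>An element fixing \<open>x\<close> fixes every \<open>C *v x\<close>, hence every
  vector.\<close>

lemma one_in: "mat 1 \<in> \<A>"
proof -
  obtain E where E: "E \<in> \<A>" "E *v x = x"
    by (rule obtain_eval)
  have "E *v v = v" for v
  proof -
    obtain C where C: "C \<in> \<A>" "C *v x = v"
      by (rule obtain_eval)
    then show ?thesis
      using E by (metis matrix_vector_mul_assoc mult_commute)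
  qed
  then have "E = mat 1"
    by (simp add: matrix_eq)
  with E show ?thesis
    by simp
qed

text \<open>Some \<open>C\<close> in the algebra agrees with the inverse at \<open>x\<close>; then
  \<open>A ** C\<close> and the identity agree at \<open>x\<close> and therefore everywhere.\<close>

lemma inv_in:
  assumes "A \<in> \<A>" "invertible A"
  shows "matrix_inv A \<in> \<A>"
proof -
  obtain C where C: "C \<in> \<A>" "C *v x = matrix_inv A *v x"
    by (rule obtain_eval)
  have "(A ** C) *v x = mat 1 *v x"
    by (metis C(2) assms(2) matrix_inv_right matrix_vector_mul_assoc)
  then have "A ** C = mat 1"
    using assms(1) C(1) by (intro eval_inject mult_in one_in)
  then show ?thesis
    using C(1) matrix_inv_eqI by metis
qed

lemma add_in: "A \<in> \<A> \<Longrightarrow> B \<in> \<A> \<Longrightarrow> A + B \<in> \<A>"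
  and diff_in: "A \<in> \<A> \<Longrightarrow> B \<in> \<A> \<Longrightarrow> A - B \<in> \<A>"
  and scaleR_in: "A \<in> \<A> \<Longrightarrow> c *\<^sub>R A \<in> \<A>"
  and minus_in: "A \<in> \<A> \<Longrightarrow> - A \<in> \<A>"
  and zero_in: "0 \<in> \<A>"
  using subspace
  by (auto intro: subspace_add subspace_diff subspace_scale subspace_neg subspace_0)

lemma mexp_in: "A \<in> \<A> \<Longrightarrow> mexp A \<in> \<A>"
  using mexp_in_subalgebra subspace one_in mult_in by blast

lemma mexp_add: "A \<in> \<A> \<Longrightarrow> B \<in> \<A> \<Longrightarrow> mexp (A + B) = mexp A ** mexp B"
  by (simp add: mexp_add_commuting mult_commute)

text \<open>The inverse of evaluation. When \<open>\<A>\<close> is identified with the vector space,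
  this is multiplication by \<open>v\<close>, with \<open>x\<close> as the unit.\<close>

definition mult_op :: "real ^ 'n \<Rightarrow> 'n mat" where
  "mult_op = inv_into \<A> (\<lambda>A. A *v x)"

lemma mult_op_in: "mult_op v \<in> \<A>"
  unfolding mult_op_def by (rule inv_into_into) (simp add: cyclic)

lemma mult_op_eval [simp]: "mult_op v *v x = v"
  unfolding mult_op_def using cyclic by (intro f_inv_into_f) auto

lemma mult_op_unique: "A \<in> \<A> \<Longrightarrow> mult_op (A *v x) = A"
  by (rule eval_inject) (simp_all add: mult_op_in)

lemma linear_mult_op: "linear mult_op"
  by (rule linearI; rule eval_inject)
    (simp_all add: mult_op_in add_in scaleR_in matrix_vector_mult_add_rdistrib
      scaleR_matrix_vector_assoc[symmetric])

lemma continuous_on_mult_op: "continuous_on S mult_op"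
  using linear_mult_op linear_continuous_on linear_conv_bounded_linear by blast

lemma dim_algebra: "dim \<A> = CARD('n)"
proof -
  have "inj mult_op"
    by (metis injI mult_op_eval)
  moreover have "range mult_op = \<A>"
    using mult_op_in mult_op_unique by (auto simp: image_iff) metis
  ultimately show ?thesis
    using dim_image_eq[OF linear_mult_op, of UNIV] by simp
qed

text \<open>Commutativity gives \<open>mexp B = mexp A ** mexp (B - A)\<close>, which moves
  continuity at \<open>A\<close> to continuity at 0.\<close>

lemma continuous_on_mexp: "continuous_on \<A> mexp"
  unfolding continuous_on
proof
  fix A assume A: "A \<in> \<A>"
  have "isCont mexp (0 :: 'n mat)"
    using has_derivative_continuous[OF mexp_has_derivative_at_0] by simp
  moreover have "((\<lambda>B. B - A) \<longlongrightarrow> 0) (at A within \<A>)"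
    by (rule LIM_zero) (rule tendsto_ident_at)
  ultimately have "((\<lambda>B. mexp (B - A)) \<longlongrightarrow> mat 1) (at A within \<A>)"
    using isCont_tendsto_compose by fastforce
  from tendsto_matrix_mult[OF tendsto_const this]
  have "((\<lambda>B. mexp A ** mexp (B - A)) \<longlongrightarrow> mexp A) (at A within \<A>)"
    by simp
  moreover have "\<forall>\<^sub>F B in at A within \<A>. mexp A ** mexp (B - A) = mexp B"
    unfolding eventually_at_topological
    using A by (auto simp: mexp_add[symmetric] diff_in intro!: exI[of _ UNIV])
  ultimately show "(mexp \<longlongrightarrow> mexp A) (at A within \<A>)"
    using tendsto_cong by fast
qed

text \<open>Evaluation at \<open>x\<close> turns the exponential into a continuous map of the vector
  space to itself whose derivative at 0 is the identity; an open mapping theorem asking for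
  differentiability at a single point applies to it.\<close>

lemma mexp_locally_surj:
  assumes "e > 0"
  obtains d where "d > 0"
    and "\<And>B. B \<in> \<A> \<Longrightarrow> norm (B - mat 1) < d \<Longrightarrow> \<exists>Z\<in>\<A>. norm Z < e \<and> mexp Z = B"
proof -
  define E where "E v = mexp (mult_op v) *v x" for v
  interpret eval: bounded_linear "\<lambda>B :: 'n mat. B *v x"
    by (rule bounded_bilinear.bounded_linear_left[OF bounded_bilinear_matrix_vector_mult])
  have bl: "bounded_linear mult_op"
    using linear_mult_op linear_conv_bounded_linear by blast
  have op0: "mult_op 0 = 0"
    using linear_0[OF linear_mult_op] .
  have "((\<lambda>v. mexp (mult_op v)) has_derivative (\<lambda>h. mult_op h)) (at 0)"
    using diff_chain_at[OF bounded_linear_imp_has_derivative[OF bl], of mexp "\<lambda>H. H" 0]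
      mexp_has_derivative_at_0
    by (simp add: o_def op0)
  from eval.has_derivative[OF this] have der: "(E has_derivative id) (at 0)"
    by (simp add: E_def[abs_def] id_def)
  have cont: "continuous_on UNIV E"
    unfolding E_def
    by (intro eval.continuous_on continuous_on_compose2[OF continuous_on_mexp continuous_on_mult_op])
      (auto simp: mult_op_in)
  have "open (mult_op -` ball 0 e)"
    using continuous_on_mult_op[of UNIV] by (simp add: open_vimage)
  then have "0 \<in> interior (mult_op -` ball 0 e)"
    using assms by (simp add: interior_open op0)
  then have "E 0 \<in> interior (E ` (mult_op -` ball 0 e))"
    by - (rule sussmann_open_mapping[OF open_UNIV cont UNIV_I der bounded_linear_ident], auto)
  then obtain r where r: "r > 0" "ball x r \<subseteq> E ` (mult_op -` ball 0 e)"
    unfolding mem_interior by (auto simp: E_def op0)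
  \<comment> \<open>\<open>K\<close> bounds evaluation at \<open>x\<close>, so the radius
    \<open>r\<close> around \<open>x\<close> becomes \<open>r / K\<close> around the identity
    matrix.\<close>
  obtain K where K: "K > 0" "\<And>B :: 'n mat. norm (B *v x) \<le> norm B * K"
    using eval.pos_bounded by auto
  show thesis
  proof
    show "r / K > 0"
      using r K by simp
    fix B assume B: "B \<in> \<A>" "norm (B - mat 1) < r / K"
    have "norm (B *v x - x) \<le> norm (B - mat 1) * K"
      using K(2)[of "B - mat 1"] by (simp add: eval.diff)
    also have "\<dots> < r"
      using B(2) K(1) by (simp add: pos_less_divide_eq)
    finally have "B *v x \<in> ball x r"
      by (simp add: dist_norm norm_minus_commute)
    then obtain v where v: "mult_op v \<in> ball 0 e" "B *v x = E v"
      using r(2) by blast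
    have "mexp (mult_op v) = B"
      using v(2) B(1) by (intro eval_inject mexp_in mult_op_in) (simp_all add: E_def)
    then show "\<exists>Z\<in>\<A>. norm Z < e \<and> mexp Z = B"
      using v(1) mult_op_in by auto
  qed
qed

text \<open>Squares are exponentials: for \<open>N = A - 1\<close> the matrices \<open>(1 + z N) (1 + cnj z N)\<close> are real and
  join the identity (at \<open>z = 0\<close>) to \<open>A\<^sup>2\<close> (at \<open>z = 1\<close>); they are singular for finitely many \<open>z\<close> only,
  and the exponentials are open and closed among the invertible elements.\<close>

lemma square_is_mexp:
  assumes A: "A \<in> \<A>" "invertible A"
  shows "\<exists>X\<in>\<A>. mexp X = A ** A"
proof -
  define N where "N = A - mat 1"
  define g where "g z = mat 1 + (2 * Re z) *\<^sub>R N + (cmod z)\<^sup>2 *\<^sub>R (N ** N)" for z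
  have N: "N \<in> \<A>"
    using A one_in by (simp add: N_def diff_in)
  then have g_in: "g z \<in> \<A>" for z
    by (simp add: g_def add_in scaleR_in one_in mult_in)
  have g_cont: "continuous_on UNIV g"
    unfolding g_def by (intro continuous_intros)
  have "A = N + mat 1"
    by (simp add: N_def)
  then have "g 1 = A ** A"
    by (simp add: g_def scaleR_2 bounded_bilinear.add_left[OF bounded_bilinear_matrix_mult]
        bounded_bilinear.add_right[OF bounded_bilinear_matrix_mult])
  have "finite {z. \<not> invertible (g z)}"
    unfolding g_def by (rule finite_singular_norm_form)
  \<comment> \<open>The parameter is complex for this step: deleting finitely many points may
    disconnect the real line but not the plane.\<close>
  then have "connected (- {z. \<not> invertible (g z)})"
    by (intro path_connected_imp_connected path_connected_complement_countable)
      (simp_all add: countable_finite)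
  moreover have "0 \<in> - {z. \<not> invertible (g z)}"
    using invertible_mexp[of "0 :: 'n mat"] by (simp add: g_def)
  moreover have "1 \<in> - {z. \<not> invertible (g z)}"
    using A(2) by (simp add: \<open>g 1 = A ** A\<close> invertible_mult)
  moreover have "\<exists>X\<in>\<A>. mexp X = g 0"
    using zero_in by (intro bexI[of _ 0]) (simp_all add: g_def)
  ultimately have "\<exists>X\<in>\<A>. mexp X = g 1"
  proof (rule connected_induction_simple[where P = "\<lambda>z. \<exists>X\<in>\<A>. mexp X = g z"])
    fix z assume "z \<in> - {z. \<not> invertible (g z)}"
    then have inv: "invertible (g z)"
      by simp
    obtain d where d: "d > 0"
      "\<And>B. B \<in> \<A> \<Longrightarrow> norm (B - mat 1) < d \<Longrightarrow> \<exists>Z\<in>\<A>. norm Z < 1 \<and> mexp Z = B"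
      by (rule mexp_locally_surj[OF zero_less_one]) blast
    \<comment> \<open>On \<open>U\<close> every \<open>g w\<close> is \<open>g z\<close> times an
      exponential, so having a logarithm passes between any two points of \<open>U\<close>.\<close>
    define U where "U = {w. norm (matrix_inv (g z) ** g w - mat 1) < d}"
    have "open U"
      unfolding U_def
      by (intro open_Collect_less continuous_intros continuous_on_matrix_mult g_cont)
    moreover have "z \<in> U"
      using inv d(1) matrix_left_right_inverse[of "g z" "matrix_inv (g z)"]
      by (simp add: U_def matrix_inv_right)
    moreover have "\<exists>X\<in>\<A>. mexp X = g w'"
      if w: "w \<in> U" "w' \<in> U" and X: "X \<in> \<A>" "mexp X = g w" for w w' X
    proof -
      have exp: "\<exists>Z\<in>\<A>. g u = g z ** mexp Z" if "u \<in> U" for u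
      proof -
        have "matrix_inv (g z) ** g u \<in> \<A>"
          by (intro mult_in inv_in inv g_in)
        with that d(2) obtain Z where "Z \<in> \<A>" "mexp Z = matrix_inv (g z) ** g u"
          unfolding U_def by blast
        then show ?thesis
          by (intro bexI[of _ Z]) (simp_all add: matrix_mul_assoc matrix_inv_right inv)
      qed
      obtain Z Z' where Z: "Z \<in> \<A>" "g w = g z ** mexp Z" "Z' \<in> \<A>" "g w' = g z ** mexp Z'"
        using exp w by meson
      \<comment> \<open>The logarithm of \<open>g w\<close> is corrected by the difference of the
        two local ones.\<close>
      have "mexp (X + (Z' - Z)) = g w ** mexp (- Z + Z')"
        using X Z by (simp add: mexp_add diff_in)
      also have "\<dots> = g z ** (mexp Z ** mexp (- Z)) ** mexp Z'"
        by (simp only: Z(2) mexp_add[OF minus_in[OF Z(1)] Z(3)] matrix_mul_assoc)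
      also have "\<dots> = g w'"
        by (simp add: mexp_minus Z(4))
      finally show ?thesis
        using X Z by (intro bexI[of _ "X + (Z' - Z)"]) (auto intro: add_in diff_in)
    qed
    ultimately show "\<exists>T. openin (top_of_set (- {z. \<not> invertible (g z)})) T \<and> z \<in> T \<and>
        (\<forall>w\<in>T. \<forall>w'\<in>T. (\<exists>X\<in>\<A>. mexp X = g w) \<longrightarrow> (\<exists>X\<in>\<A>. mexp X = g w'))"
      using inv
      by (intro exI[of _ "- {z. \<not> invertible (g z)} \<inter> U"]) (auto intro: openin_open_Int)
  qed
  then show ?thesis
    by (simp add: \<open>g 1 = A ** A\<close>)
qed

text \<open>One inclusion tests \<open>A\<close> with linear functionals vanishing on the algebra.
  For the other, a polynomial vanishing on \<open>S\<close> vanishes by continuity on an open part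
  of the algebra, hence on every line through its centre.\<close>

lemma zariski_closure_eq_units:
  assumes "S \<subseteq> \<A>" and r: "r > 0" "\<And>w. w \<in> ball v r \<Longrightarrow> mult_op w \<in> closure S"
  shows "zariski_closure_GL S = {A \<in> \<A>. invertible A}"
proof (intro equalityI subsetI)
  fix A assume A: "A \<in> zariski_closure_GL S"
  obtain Y Z where YZ: "Y \<in> span \<A>" "\<And>W. W \<in> span \<A> \<Longrightarrow> orthogonal Z W" "A = Y + Z"
    using orthogonal_subspace_decomp_exists[of \<A> A] by blast
  have "(\<lambda>B. Z \<bullet> B) \<in> poly_fun" "\<forall>B\<in>S. Z \<bullet> B = 0"
    using YZ(2) assms(1) span_base by (auto simp: poly_fun_inner orthogonal_def)
  then have "Z \<bullet> A = 0"
    using A by (auto simp: zariski_closure_GL_def)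
  moreover have "Z \<bullet> Y = 0"
    using YZ by (simp add: orthogonal_def)
  ultimately have "A = Y"
    by (simp add: YZ(3) inner_add_right)
  then show "A \<in> {A \<in> \<A>. invertible A}"
    using A YZ(1) span_eq_iff[THEN iffD2, OF subspace] by (simp add: zariski_closure_GL_def)
next
  fix A assume A: "A \<in> {A \<in> \<A>. invertible A}"
  have "p A = 0" if p: "p \<in> poly_fun" "\<forall>B\<in>S. p B = 0" for p
  proof -
    have zero: "p B = 0" if "B \<in> closure S" for B
      using continuous_constant_on_closure[OF continuous_on_poly_fun[OF p(1)] _ that] p(2) by blast
    define h where "h = A *v x - v"
    obtain q where q: "\<And>t. p (mult_op v + t *\<^sub>R mult_op h) = poly q t"
      using poly_fun_affine_line[OF p(1)] by metis
    have mult_op_line: "mult_op v + t *\<^sub>R mult_op h = mult_op (v + t *\<^sub>R h)" for t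
      by (simp add: linear_add[OF linear_mult_op] linear_scale[OF linear_mult_op])
    \<comment> \<open>Adding 1 keeps the denominator positive when \<open>h = 0\<close>.\<close>
    define \<delta> where "\<delta> = r / (norm h + 1)"
    have h_pos: "norm h + 1 > 0"
      using norm_ge_zero[of h] by linarith
    have \<delta>: "\<delta> > 0" "\<delta> * norm h < r"
      using r(1) h_pos by (simp_all add: \<delta>_def pos_divide_less_eq distrib_left)
    have "poly q t = 0" if "t \<in> {0<..<\<delta>}" for t
    proof -
      have "\<bar>t\<bar> * norm h \<le> \<delta> * norm h"
        using that by (intro mult_right_mono) auto
      then have "v + t *\<^sub>R h \<in> ball v r"
        using \<delta>(2) by (simp add: dist_norm)
      then show ?thesis
        using r(2) zero q mult_op_line by metis
    qed
    then have "infinite {t. poly q t = 0}"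
      using \<delta>(1) infinite_Ioo[of 0 \<delta>] by (meson finite_subset mem_Collect_eq subsetI)
    then have "q = 0"
      using poly_roots_finite by blast
    then have "p (mult_op (v + 1 *\<^sub>R h)) = 0"
      using q[of 1] mult_op_line[of 1] by simp
    then show ?thesis
      using A by (simp add: h_def mult_op_unique)
  qed
  then show "A \<in> zariski_closure_GL S"
    using A by (simp add: zariski_closure_GL_def)
qed

text \<open>The exponentials of multiples of \<open>J\<close> have period 1, so they form a compact
  connected group. By commutativity its product with \<open>T\<close> is one too, and equals
  \<open>T\<close> by maximality; \<open>J\<close> is the velocity at 0.\<close>

lemma mexp_kernel_in_lie_algebra:
  assumes T: "maximal_compact_connected_subgroup T {A \<in> \<A>. invertible A}"
    and J: "J \<in> \<A>" "mexp J = mat 1"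
  shows "J \<in> lie_algebra T"
proof -
  define c where "c t = mexp (t *\<^sub>R J)" for t
  have c_add: "c (s + t) = c s ** c t" for s t
    by (simp add: c_def scaleR_add_left mexp_add scaleR_in J)
  have c_nat: "c (of_nat k) = mat 1" for k
    by (induction k) (simp_all add: c_def scaleR_add_left mexp_add scaleR_in J)
  have c_int: "c (of_int k) = mat 1" for k
  proof (cases "k \<ge> 0")
    case True
    then show ?thesis
      using c_nat[of "nat k"] by simp
  next
    case False
    then have "c (of_int k) ** c (of_nat (nat (- k))) = mat 1"
      by (subst c_add[symmetric]) (simp add: c_def)
    then show ?thesis
      by (simp only: c_nat matrix_mul_rid)
  qed
  have c_frac: "c t = c (frac t)" for t
    using c_add[of "frac t" "of_int \<lfloor>t\<rfloor>"] by (simp add: c_int frac_def)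
  have c_cont: "continuous_on U c" for U
    unfolding c_def by (rule continuous_on_mexp_scaleR)
  have c_unit: "c t \<in> \<A>" "invertible (c t)" for t
    by (simp_all add: c_def mexp_in scaleR_in J invertible_mexp)
  have sub: "T \<subseteq> \<A>" and gT: "is_subgroup_GL T" and "compact T" "connected T"
    and max: "\<And>H. compact_connected_subgroup H {A \<in> \<A>. invertible A} \<Longrightarrow> T \<subseteq> H \<Longrightarrow> H = T"
    using T by (auto simp: maximal_compact_connected_subgroup_def compact_connected_subgroup_def)
  have oneT: "mat 1 \<in> T" and invT: "\<And>A. A \<in> T \<Longrightarrow> invertible A"
    and multT: "\<And>A B. A \<in> T \<Longrightarrow> B \<in> T \<Longrightarrow> A ** B \<in> T"
    and minvT: "\<And>A. A \<in> T \<Longrightarrow> matrix_inv A \<in> T"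
    using gT by (auto simp: is_subgroup_GL_def)
  \<comment> \<open>Restricting \<open>t\<close> to the unit interval makes compactness and
    connectedness immediate; periodicity lifts the restriction in \<open>H_iff\<close>.\<close>
  define H where "H = (\<lambda>(A, t). A ** c t) ` (T \<times> {0..1})"
  have H_iff: "B \<in> H \<longleftrightarrow> (\<exists>A\<in>T. \<exists>t. B = A ** c t)" for B
  proof
    assume "\<exists>A\<in>T. \<exists>t. B = A ** c t"
    then obtain A t where "A \<in> T" "B = A ** c (frac t)"
      using c_frac by metis
    moreover have "frac t \<in> {0..1}"
      using frac_lt_1[of t] by simp
    ultimately show "B \<in> H"
      by (auto simp: H_def intro!: image_eqI[of _ _ "(A, frac t)"])
  qed (auto simp: H_def)
  have "continuous_on (T \<times> {0..1}) (\<lambda>(A, t). A ** c t)"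
    unfolding case_prod_beta
    by (intro continuous_on_matrix_mult continuous_on_compose2[OF c_cont] continuous_intros) auto
  then have "compact H" "connected H"
    unfolding H_def using \<open>compact T\<close> \<open>connected T\<close>
    by (auto intro!: compact_continuous_image connected_continuous_image compact_Times connected_Times
        connected_Icc)
  moreover have "H \<subseteq> {A \<in> \<A>. invertible A}"
    using sub invT c_unit by (auto simp: H_iff intro!: mult_in invertible_mult)
  moreover have "is_subgroup_GL H"
    unfolding is_subgroup_GL_def
  proof (intro conjI ballI)
    show "mat 1 \<in> H"
      unfolding H_iff using oneT by (intro bexI[of _ "mat 1"] exI[of _ 0]) (simp_all add: c_def)
    show "invertible A" if "A \<in> H" for A
      using that invT c_unit by (auto simp: H_iff intro!: invertible_mult)
    show "A ** B \<in> H" if "A \<in> H" "B \<in> H" for A B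
    proof -
      from that obtain A' s B' t where AB: "A' \<in> T" "A = A' ** c s" "B' \<in> T" "B = B' ** c t"
        by (auto simp: H_iff)
      have "c s ** B' = B' ** c s"
        using AB sub c_unit by (intro mult_commute) auto
      then have "A ** B = (A' ** B') ** c (s + t)"
        by (metis AB(2,4) c_add matrix_mul_assoc)
      then show ?thesis
        using AB multT by (auto simp: H_iff)
    qed
    show "matrix_inv A \<in> H" if "A \<in> H" for A
    proof -
      from that obtain A' t where A: "A' \<in> T" "A = A' ** c t"
        by (auto simp: H_iff)
      have "c t ** matrix_inv A' = matrix_inv A' ** c t"
        using A sub c_unit minvT by (intro mult_commute) auto
      then have "A ** (matrix_inv A' ** c (- t)) = (A' ** matrix_inv A') ** (c t ** c (- t))"
        by (metis A(2) matrix_mul_assoc)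
      also have "\<dots> = mat 1"
        using invT[OF A(1)] by (simp add: matrix_inv_right c_def mexp_minus)
      finally have "matrix_inv A = matrix_inv A' ** c (- t)"
        by (rule matrix_inv_eqI)
      then show ?thesis
        using A minvT by (auto simp: H_iff)
    qed
  qed
  moreover have "T \<subseteq> H"
  proof
    fix A assume "A \<in> T"
    then show "A \<in> H"
      unfolding H_iff by (intro bexI[of _ A] exI[of _ 0]) (simp_all add: c_def)
  qed
  ultimately have "H = T"
    by (intro max) (simp_all add: compact_connected_subgroup_def)
  have "c t \<in> T" for t
  proof -
    have "mat 1 ** c t \<in> H"
      using oneT H_iff by blast
    then show ?thesis
      by (simp add: \<open>H = T\<close>)
  qed
  moreover have "c 0 = mat 1" "(c has_vector_derivative J) (at 0)"
    using mexp_scaleR_has_vector_derivative[of J 0] by (simp_all add: c_def[abs_def])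
  ultimately show ?thesis
    by (auto simp: lie_algebra_def)
qed

end

section \<open>Generators of semigroups with a somewhere dense orbit\<close>

lemma span_matrix_mult_closed:
  fixes S :: "'n::finite mat set"
  assumes "\<And>A B. A \<in> S \<Longrightarrow> B \<in> S \<Longrightarrow> A ** B \<in> S" and A: "A \<in> span S" and B: "B \<in> span S"
  shows "A ** B \<in> span S"
proof -
  interpret m: bounded_bilinear "(**) :: 'n mat \<Rightarrow> 'n mat \<Rightarrow> 'n mat"
    by (rule bounded_bilinear_matrix_mult)
  have left: "C ** B \<in> span S" if "C \<in> S" for C
    using B
  proof (induction rule: span_induct_alt)
    case base
    show ?case
      by (simp add: m.zero_right span_zero)
  next
    case (step c D E)
    then show ?case
      using that assms(1) by (simp add: m.add_right m.scaleR_right span_add span_scale span_base)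
  qed
  from A show ?thesis
  proof (induction rule: span_induct_alt)
    case base
    show ?case
      by (simp add: m.zero_left span_zero)
  next
    case (step c D E)
    then show ?case
      by (simp add: left m.add_left m.scaleR_left span_add span_scale)
  qed
qed

lemma span_matrix_mult_commute:
  fixes S :: "'n::finite mat set"
  assumes "\<And>A B. A \<in> S \<Longrightarrow> B \<in> S \<Longrightarrow> A ** B = B ** A" and A: "A \<in> span S" and B: "B \<in> span S"
  shows "A ** B = B ** A"
proof -
  interpret m: bounded_bilinear "(**) :: 'n mat \<Rightarrow> 'n mat \<Rightarrow> 'n mat"
    by (rule bounded_bilinear_matrix_mult)
  have left: "C ** B = B ** C" if "C \<in> S" for C
    using B
  proof (induction rule: span_induct_alt)
    case (step c D E)
    then show ?case
      using that assms(1) by (simp add: m.add_right m.add_left m.scaleR_right m.scaleR_left)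
  qed (simp add: m.zero_right m.zero_left)
  from A show ?thesis
  proof (induction rule: span_induct_alt)
    case (step c D E)
    then show ?case
      by (simp add: left m.add_right m.add_left m.scaleR_right m.scaleR_left)
  qed (simp add: m.zero_right m.zero_left)
qed

text \<open>A proper subspace is closed and has empty interior.\<close>

lemma span_eq_UNIV_if_somewhere_dense:
  fixes X :: "'a::euclidean_space set"
  assumes "interior (closure X) \<noteq> {}"
  shows "span X = UNIV"
proof (rule ccontr)
  assume "span X \<noteq> UNIV"
  then have "interior (span X) = {}"
    by (metis dim_eq_full dim_subset_UNIV empty_interior_lowdim le_neq_implies_less span_span)
  moreover have "closure X \<subseteq> span X"
    by (simp add: closure_minimal span_superset)
  ultimately show False
    using assms interior_mono by blast
qed

lemma dim_Un_le_card:
  fixes V C :: "'a::euclidean_space set"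
  assumes "finite C"
  shows "dim (V \<union> C) \<le> dim V + card C"
proof -
  obtain B where "B \<subseteq> V" and B: "independent B" "V \<subseteq> span B" "card B = dim V"
    by (rule basis_exists)
  have "V \<union> C \<subseteq> span (B \<union> C)"
    using B(2) span_mono[of B "B \<union> C"] span_superset[of "B \<union> C"] by blast
  then have "dim (V \<union> C) \<le> card (B \<union> C)"
    using assms B(1) independent_imp_finite by (intro dim_le_card) auto
  also have "\<dots> \<le> dim V + card C"
    using card_Un_le[of B C] B(3) by simp
  finally show ?thesis .
qed

text \<open>Evaluation at \<open>x\<close> maps the span of \<open>S\<close> onto the span of the
  orbit, which is the whole space.\<close>

lemma cyclic_algebra_span:
  assumes "\<And>A B. A \<in> S \<Longrightarrow> B \<in> S \<Longrightarrow> A ** B \<in> S" "\<And>A B. A \<in> S \<Longrightarrow> B \<in> S \<Longrightarrow> A ** B = B ** A"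
    and "interior (closure (orbit S x)) \<noteq> {}"
  shows "cyclic_algebra (span S) x"
proof
  have "linear (\<lambda>A :: 'a mat. A *v x)"
    using bounded_bilinear.bounded_linear_left[OF bounded_bilinear_matrix_vector_mult]
    by (rule bounded_linear.linear)
  then have "(\<lambda>A. A *v x) ` span S = span ((\<lambda>A. A *v x) ` S)"
    by (simp add: linear_span_image)
  also have "(\<lambda>A. A *v x) ` S = orbit S x"
    by (auto simp: orbit_def)
  finally show "(\<lambda>A. A *v x) ` span S = UNIV"
    using span_eq_UNIV_if_somewhere_dense[OF assms(3)] by simp
  show "A ** B \<in> span S" if "A \<in> span S" "B \<in> span S" for A B
    using assms(1) that by (rule span_matrix_mult_closed)
  show "A ** B = B ** A" if "A \<in> span S" "B \<in> span S" for A B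
    using assms(2) that by (rule span_matrix_mult_commute)
qed (rule subspace_span)

lemma matrix_inv_one [simp]: "matrix_inv (mat 1 :: 'n::finite mat) = mat 1"
  by (rule matrix_inv_eqI) simp

lemma grp_gen_empty: "grp_gen {} = {mat 1 :: 'n::finite mat}"
proof -
  have "A = mat 1" if "A \<in> grp_gen {}" for A :: "'n mat"
    using that by induction auto
  then show ?thesis
    using grp_gen.one by blast
qed

lemma sgr_gen_empty: "sgr_gen {} = ({} :: 'n::finite mat set)"
proof -
  have "False" if "A \<in> sgr_gen {}" for A :: "'n mat"
    using that by induction auto
  then show ?thesis
    by blast
qed

section \<open>Logarithms of squares with integral values\<close>

context cyclic_algebra
begin

text \<open>Squares appear because \<open>square_is_mexp\<close> provides logarithms for them.
  Asking for one suitable logarithm makes the property pass to products and inverses.\<close>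

definition int_log :: "'n mat \<Rightarrow> 'n mat \<Rightarrow> bool" where
  "int_log D A \<longleftrightarrow> (\<exists>Y\<in>\<A>. mexp Y = A ** A \<and> D \<bullet> Y \<in> \<int>)"

lemma int_log_mult:
  assumes "A \<in> \<A>" "B \<in> \<A>" "int_log D A" "int_log D B"
  shows "int_log D (A ** B)"
proof -
  obtain Y Z where "Y \<in> \<A>" "mexp Y = A ** A" "D \<bullet> Y \<in> \<int>" "Z \<in> \<A>" "mexp Z = B ** B" "D \<bullet> Z \<in> \<int>"
    using assms(3,4) by (auto simp: int_log_def)
  moreover have "(A ** A) ** (B ** B) = (A ** B) ** (A ** B)"
    by (metis assms(1,2) matrix_mul_assoc mult_commute)
  ultimately show ?thesis
    unfolding int_log_def
    by (intro bexI[of _ "Y + Z"]) (simp_all add: mexp_add add_in inner_add_right)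
qed

lemma int_log_inv:
  assumes "A \<in> \<A>" "invertible A" "int_log D A"
  shows "int_log D (matrix_inv A)"
proof -
  obtain Y where Y: "Y \<in> \<A>" "mexp Y = A ** A" "D \<bullet> Y \<in> \<int>"
    using assms(3) by (auto simp: int_log_def)
  have "mexp Y ** (matrix_inv A ** matrix_inv A) = A ** (A ** matrix_inv A) ** matrix_inv A"
    by (simp add: Y(2) matrix_mul_assoc)
  also have "\<dots> = mat 1"
    by (simp add: assms(2) matrix_inv_right)
  finally have "mexp (- Y) = matrix_inv A ** matrix_inv A"
    using matrix_inv_eqI mexp_minus by metis
  then show ?thesis
    using Y unfolding int_log_def by (intro bexI[of _ "- Y"]) (simp_all add: minus_in)
qed

lemma int_log_one: "int_log D (mat 1)"
  unfolding int_log_def by (intro bexI[of _ 0]) (simp_all add: zero_in)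

lemma int_log_sgr_gen:
  assumes "A \<in> sgr_gen F" "sgr_gen F \<subseteq> \<A>" "\<And>B. B \<in> F \<Longrightarrow> int_log D B"
  shows "int_log D A"
  using assms(1)
proof induction
  case (mult A B)
  then show ?case
    using assms(2) int_log_mult by blast
qed (use assms(3) in simp)

lemma int_log_grp_gen:
  assumes "A \<in> grp_gen F" "grp_gen F \<subseteq> \<A>" "\<And>B. B \<in> grp_gen F \<Longrightarrow> invertible B"
    "\<And>B. B \<in> F \<Longrightarrow> int_log D B"
  shows "int_log D A"
  using assms(1)
proof induction
  case (mult A B)
  then show ?case
    using assms(2) int_log_mult by blast
next
  case (inv A)
  then show ?case
    using assms(2,3) int_log_inv by blast
qed (use assms(4) int_log_one in auto)

text \<open>If \<open>D\<close> vanishes on the kernel of the exponential, then \<open>D \<bullet> Y\<close> depends only on \<open>mexp Y\<close>, and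
  moves continuously along \<open>t \<mapsto> s ** mexp (t *\<^sub>R D)\<close>.\<close>

lemma not_somewhere_dense_if_int_log:
  assumes D: "D \<in> \<A>" "D \<noteq> 0" and ker: "\<And>J. J \<in> \<A> \<Longrightarrow> mexp J = mat 1 \<Longrightarrow> D \<bullet> J = 0"
    and S: "S \<subseteq> \<A>" "\<And>A. A \<in> S \<Longrightarrow> invertible A" "\<And>A. A \<in> S \<Longrightarrow> int_log D A"
    and r: "r > 0" "\<And>w. w \<in> ball v r \<Longrightarrow> mult_op w \<in> closure S"
  shows False
proof -
  interpret eval: bounded_linear "\<lambda>B :: 'n mat. B *v x"
    by (rule bounded_bilinear.bounded_linear_left[OF bounded_bilinear_matrix_vector_mult])
  \<comment> \<open>Two logarithms of the same square differ by a kernel element, on which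
    \<open>D\<close> vanishes; so integrality of one gives that of all.\<close>
  have int: "D \<bullet> Y \<in> \<int>" if "A \<in> S" "Y \<in> \<A>" "mexp Y = A ** A" for A Y
  proof -
    obtain Y' where Y': "Y' \<in> \<A>" "mexp Y' = A ** A" "D \<bullet> Y' \<in> \<int>"
      using S(3) \<open>A \<in> S\<close> by (auto simp: int_log_def)
    have "mexp (Y + - Y') = mat 1"
      using that Y' mexp_minus[of Y'] by (subst mexp_add) (simp_all add: minus_in)
    then have "D \<bullet> (Y - Y') = 0"
      using that Y' by (intro ker) (simp_all add: diff_in)
    then show ?thesis
      using Y'(3) by (simp add: inner_diff_right)
  qed
  have "mult_op v \<in> closure S"
    using r by simp
  \<comment> \<open>The ball is pulled back to matrices along evaluation, so that an actual element
    of \<open>S\<close> is found with its value in the ball.\<close>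
  moreover have "open {B. dist v (B *v x) < r}"
    by (intro open_Collect_less continuous_intros eval.continuous_on)
  moreover have "mult_op v \<in> {B. dist v (B *v x) < r}"
    using r(1) by simp
  ultimately obtain s where s: "s \<in> S" "s *v x \<in> ball v r"
    by (metis (no_types, lifting) closure_iff_nhds_not_empty disjoint_iff mem_Collect_eq mem_ball subset_refl)
  have s': "s \<in> \<A>" "invertible s"
    using s(1) S by auto
  obtain Y where Y: "Y \<in> \<A>" "mexp Y = s ** s" "D \<bullet> Y \<in> \<int>"
    using S(3)[OF s(1)] by (auto simp: int_log_def)
  define a where "a t = s ** mexp (t *\<^sub>R D)" for t
  have a: "a t \<in> \<A>" "invertible (a t)" for t
    unfolding a_def using s' D(1) by (auto intro: mult_in mexp_in scaleR_in invertible_mult invertible_mexp)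
  have "continuous_on UNIV (\<lambda>t. a t *v x)"
    unfolding a_def
    by (intro eval.continuous_on continuous_on_matrix_mult continuous_on_mexp_scaleR continuous_intros)
  then have "((\<lambda>t. a t *v x) \<longlongrightarrow> a 0 *v x) (at 0)"
    by (simp add: continuous_on_eq_continuous_at isCont_def)
  moreover have "a 0 *v x \<in> ball v r"
    using s by (simp add: a_def)
  ultimately have "\<forall>\<^sub>F t in at 0. a t *v x \<in> ball v r"
    by (rule topological_tendstoD[OF _ open_ball])
  then obtain \<delta> where \<delta>: "\<delta> > 0" "\<And>t. t \<noteq> 0 \<Longrightarrow> dist t 0 < \<delta> \<Longrightarrow> a t *v x \<in> ball v r"
    by (auto simp: eventually_at)
  have DD: "D \<bullet> D > 0"
    using D(2) by simp
  \<comment> \<open>\<open>\<delta> / 2\<close> keeps \<open>a t *v x\<close> in the ball; the other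
    bound keeps the change of the functional below 1.\<close>
  define t where "t = min (\<delta> / 2) (1 / (8 * (D \<bullet> D)))"
  have t: "t > 0" "t < \<delta>" "t * (D \<bullet> D) \<le> 1 / 8"
    using \<delta>(1) DD by (auto simp: t_def min_def field_simps)
  have "a t \<in> closure S"
    using r(2)[OF \<delta>(2)[of t]] t a(1) by (simp add: mult_op_unique)
  \<comment> \<open>With \<open>norm Z < e\<close>, Cauchy-Schwarz makes the main term
    \<open>2 * t * (D \<bullet> D)\<close> outweigh the error
    \<open>2 * (D \<bullet> Z)\<close>.\<close>
  define e where "e = t * norm D"
  have "e > 0"
    using t(1) D(2) by (simp add: e_def)
  then obtain d where d: "d > 0"
      "\<And>B. B \<in> \<A> \<Longrightarrow> norm (B - mat 1) < d \<Longrightarrow> \<exists>Z\<in>\<A>. norm Z < e \<and> mexp Z = B"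
    by (rule mexp_locally_surj) blast
  have "open {B. norm (matrix_inv (a t) ** B - mat 1) < d}"
    by (intro open_Collect_less continuous_intros continuous_on_matrix_mult)
  moreover have "a t \<in> {B. norm (matrix_inv (a t) ** B - mat 1) < d}"
    using a(2) d(1) matrix_left_right_inverse[of "a t" "matrix_inv (a t)"]
    by (simp add: matrix_inv_right)
  ultimately obtain A where A: "A \<in> S" "norm (matrix_inv (a t) ** A - mat 1) < d"
    using \<open>a t \<in> closure S\<close>
    by (metis (no_types, lifting) closure_iff_nhds_not_empty disjoint_iff mem_Collect_eq subset_refl)
  have "matrix_inv (a t) ** A \<in> \<A>"
    using a A(1) S(1) by (intro mult_in inv_in) auto
  with d(2) A(2) obtain Z where Z: "Z \<in> \<A>" "norm Z < e" "mexp Z = matrix_inv (a t) ** A"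
    by blast
  have "a t ** mexp Z = A"
    by (simp add: Z(3) matrix_mul_assoc matrix_inv_right a)
  then have A_eq: "A = s ** mexp (t *\<^sub>R D + Z)"
    using Z(1) D(1) by (simp add: a_def matrix_mul_assoc mexp_add scaleR_in)
  define W where "W = t *\<^sub>R D + Z"
  have W: "W \<in> \<A>"
    using Z(1) D(1) by (simp add: W_def add_in scaleR_in)
  \<comment> \<open>\<open>Y + (W + W)\<close> is a logarithm of the square of an element of
    \<open>S\<close>, so the functional is integral on it as well as on \<open>Y\<close>.\<close>
  have "mexp (Y + (W + W)) = (s ** s) ** (mexp W ** mexp W)"
    by (simp only: mexp_add[OF Y(1) add_in[OF W W]] mexp_add[OF W W] Y(2))
  also have "\<dots> = A ** A"
    unfolding A_eq W_def[symmetric] by (metis W s'(1) matrix_mul_assoc mexp_in mult_commute)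
  finally have "D \<bullet> (Y + (W + W)) \<in> \<int>"
    using A(1) W Y(1) by (intro int[OF A(1)] add_in)
  then have "D \<bullet> (W + W) \<in> \<int>"
    using Y(3) Ints_diff by (fastforce simp: inner_add_right)
  moreover have "D \<bullet> (W + W) = 2 * t * (D \<bullet> D) + 2 * (D \<bullet> Z)"
    unfolding W_def inner_add_right inner_scaleR_right by simp
  ultimately obtain k :: int where k: "2 * t * (D \<bullet> D) + 2 * (D \<bullet> Z) = of_int k"
    by (metis Ints_cases)
  have "\<bar>D \<bullet> Z\<bar> \<le> norm D * norm Z"
    by (rule Cauchy_Schwarz_ineq2)
  also have "\<dots> < norm D * e"
    using Z(2) D(2) by simp
  also have "\<dots> = t * (D \<bullet> D)"
    by (simp add: e_def dot_square_norm power2_eq_square)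
  finally have "\<bar>D \<bullet> Z\<bar> < t * (D \<bullet> D)" .
  \<comment> \<open>This places the integer \<open>k\<close> strictly between 0 and 1.\<close>
  then have "(0 :: real) < of_int k" "of_int k < (1 :: real)"
    unfolding k[symmetric] using t(3) by linarith+
  then show False
    by simp
qed

text \<open>Orthogonality is demanded only on the kernel and on the logarithms for all generators
  but one; the value at the remaining one is made integral by scaling. The condition saved accounts
  for the \<open>+ 1\<close> in the final bound.\<close>

lemma exists_int_log_functional:
  assumes F: "finite F" "F \<noteq> {}" "F \<subseteq> \<A>" "\<And>A. A \<in> F \<Longrightarrow> invertible A"
    and dim: "card F + dim {J \<in> \<A>. mexp J = mat 1} \<le> CARD('n)"
  obtains D where "D \<in> \<A>" "D \<noteq> 0" "\<And>J. J \<in> \<A> \<Longrightarrow> mexp J = mat 1 \<Longrightarrow> D \<bullet> J = 0"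
    "\<And>A. A \<in> F \<Longrightarrow> int_log D A"
proof -
  have "\<forall>A\<in>F. \<exists>X. X \<in> \<A> \<and> mexp X = A ** A"
    using F square_is_mexp by blast
  then obtain X where X: "\<And>A. A \<in> F \<Longrightarrow> X A \<in> \<A>" "\<And>A. A \<in> F \<Longrightarrow> mexp (X A) = A ** A"
    by metis
  obtain A0 where A0: "A0 \<in> F"
    using F(2) by blast
  define K where "K = {J \<in> \<A>. mexp J = mat 1}"
  define L where "L = K \<union> X ` (F - {A0})"
  have spanA: "span \<A> = \<A>"
    by (rule span_eq_iff[THEN iffD2, OF subspace])
  have "L \<subseteq> \<A>"
    using X(1) by (auto simp: L_def K_def)
  then have "span L \<subseteq> span \<A>"
    by (rule span_mono)
  moreover have "span L \<noteq> span \<A>"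
  proof
    assume "span L = span \<A>"
    then have "CARD('n) = dim L"
      by (metis dim_algebra dim_span)
    also have "\<dots> \<le> dim K + card (X ` (F - {A0}))"
      unfolding L_def using F(1) by (intro dim_Un_le_card) simp
    also have "\<dots> \<le> dim K + card (F - {A0})"
      using F(1) by (simp add: card_image_le)
    finally have "CARD('n) \<le> dim K + card (F - {A0})" .
    moreover have "card (F - {A0}) < card F"
      using F(1) A0 by (rule card_Diff1_less)
    ultimately show False
      using dim by (simp add: K_def)
  qed
  ultimately have "span L \<subset> span \<A>"
    by blast
  then obtain D0 where D0: "D0 \<noteq> 0" "D0 \<in> span \<A>" "\<And>Y. Y \<in> span L \<Longrightarrow> orthogonal D0 Y"
    by (rule orthogonal_to_subspace_exists_gen) blast
  \<comment> \<open>The scaled functional takes the value 1 at \<open>X A0\<close>, or 0 if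
    \<open>D0\<close> already vanishes there; the factor 1 is then a default.\<close>
  define c where "c = (if D0 \<bullet> X A0 = 0 then 1 else inverse (D0 \<bullet> X A0))"
  have "c \<noteq> 0"
    by (simp add: c_def)
  have perp: "D0 \<bullet> Y = 0" if "Y \<in> L" for Y
    using D0(3) that by (simp add: orthogonal_def span_base)
  show thesis
  proof
    show "c *\<^sub>R D0 \<in> \<A>" "c *\<^sub>R D0 \<noteq> 0"
      using D0 \<open>c \<noteq> 0\<close> by (simp_all add: spanA scaleR_in)
    show "c *\<^sub>R D0 \<bullet> J = 0" if "J \<in> \<A>" "mexp J = mat 1" for J
      using that perp by (simp add: L_def K_def)
    show "int_log (c *\<^sub>R D0) A" if "A \<in> F" for A
      unfolding int_log_def
    proof (intro bexI conjI)
      show "c *\<^sub>R D0 \<bullet> X A \<in> \<int>"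
      proof (cases "A = A0")
        case True
        then show ?thesis
          by (simp add: c_def)
      next
        case False
        then show ?thesis
          using that perp by (simp add: L_def)
      qed
    qed (use X that in auto)
  qed
qed

end

theorem theorem5p1:
  fixes S :: "('n::finite) mat set" and T :: "'n mat set"
  assumes "is_subsemigroup_GL S"
    and "\<forall>A\<in>S. \<forall>B\<in>S. A ** B = B ** A"
    and "maximal_compact_connected_subgroup T (zariski_closure_GL S)"
    and "somewhere_dense_orbit S"
  shows "\<forall>F. finite F \<and> (S = sgr_gen F \<or> S = grp_gen F) \<longrightarrow>
           card F + lie_dim T \<ge> CARD('n) + 1"
proof (intro allI impI, elim conjE)
  fix F :: "'n mat set"
  assume F: "finite F" and gen: "S = sgr_gen F \<or> S = grp_gen F"
  obtain x where x: "interior (closure (orbit S x)) \<noteq> {}"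
    using assms(4) by (auto simp: somewhere_dense_orbit_def)
  have S: "S \<noteq> {}" "\<And>A. A \<in> S \<Longrightarrow> invertible A" "\<And>A B. A \<in> S \<Longrightarrow> B \<in> S \<Longrightarrow> A ** B \<in> S"
    using assms(1) by (auto simp: is_subsemigroup_GL_def)
  interpret cyclic_algebra "span S" x
    using S(3) assms(2) x by (intro cyclic_algebra_span) auto
  have "F \<subseteq> S"
    using gen by (auto intro: sgr_gen.base grp_gen.base)
  \<comment> \<open>A generator to normalise at is needed below. Without generators \<open>S\<close>
    would be trivial and its orbits single points, which have empty interior since the dimension is
    positive.\<close>
  have "F \<noteq> {}"
  proof
    assume "F = {}"
    then have "S = {mat 1}"
      using gen S(1) by (auto simp: sgr_gen_empty grp_gen_empty)
    then have "orbit S x = {x}"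
      by (auto simp: orbit_def)
    then show False
      using x by simp
  qed
  obtain v r where r: "r > 0" "ball v r \<subseteq> closure (orbit S x)"
    using x by (auto simp: mem_interior)
  \<comment> \<open>\<open>mult_op\<close> is continuous and maps the orbit back into
    \<open>S\<close>, so density of the orbit in the ball becomes density of \<open>S\<close> in the
    image of the ball.\<close>
  have dense: "mult_op w \<in> closure S" if "w \<in> ball v r" for w
  proof -
    have "mult_op ` orbit S x \<subseteq> S"
      by (auto simp: orbit_def mult_op_unique span_base)
    moreover have "mult_op ` closure (orbit S x) \<subseteq> closure (mult_op ` orbit S x)"
      using continuous_on_mult_op
      by (intro image_closure_subset closure_subset) auto
    ultimately show ?thesis
      using that r(2) closure_mono by blast
  qed
  have "zariski_closure_GL S = {A \<in> span S. invertible A}"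
    using span_superset r(1) dense by (rule zariski_closure_eq_units)
  \<comment> \<open>Now that the Zariski closure is the group of units, \<open>T\<close> is maximal
    in that group, as the lemma on the kernel demands.\<close>
  then have "{J \<in> span S. mexp J = mat 1} \<subseteq> lie_algebra T"
    using assms(3) mexp_kernel_in_lie_algebra by auto
  then have ker: "dim {J \<in> span S. mexp J = mat 1} \<le> lie_dim T"
    by (simp add: lie_dim_def dim_subset)
  show "CARD('n) + 1 \<le> card F + lie_dim T"
  proof (rule ccontr)
    assume "\<not> CARD('n) + 1 \<le> card F + lie_dim T"
    then have "card F + dim {J \<in> span S. mexp J = mat 1} \<le> CARD('n)"
      using ker by linarith
    moreover have "F \<subseteq> span S" "\<And>A. A \<in> F \<Longrightarrow> invertible A"
      using \<open>F \<subseteq> S\<close> span_superset S(2) by blast+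
    ultimately obtain D where D: "D \<in> span S" "D \<noteq> 0" "\<And>J. J \<in> span S \<Longrightarrow> mexp J = mat 1 \<Longrightarrow> D \<bullet> J = 0"
      "\<And>A. A \<in> F \<Longrightarrow> int_log D A"
      using exists_int_log_functional[OF F \<open>F \<noteq> {}\<close>] by blast
    have "int_log D A" if "A \<in> S" for A
      using gen
    proof
      assume "S = sgr_gen F"
      then show ?thesis
        using that D(4) span_superset int_log_sgr_gen by metis
    next
      assume "S = grp_gen F"
      then show ?thesis
        using that D(4) S(2) span_superset int_log_grp_gen by metis
    qed
    then show False
      using not_somewhere_dense_if_int_log[OF D(1-3) span_superset S(2) _ r(1) dense] by blast
  qed
qed

end
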